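(* Let $p>0$ and $q\geqslant 0$ be real numbers. There is no Killing vector field $\sigma$ on the round unit sphere $\mathbb{S}^2$ that is not identically zero and is $(p,q)$-harmonic.
   Context: A vector field $\sigma$ on a Riemannian manifold $(M,g)$ with Levi-Civita connection $\nabla$ is called $(p,q)$-harmonic if $$(1+|\sigma|^2)\nabla^*\nabla\sigma+2p\,\nabla_{X(\sigma)}\sigma=\Big[p|\nabla\sigma|^2-pq|X(\sigma)|^2-q(1+|\sigma|^2)\Delta\big(\tfrac{|\sigma|^2}{2}\big)\Big]\sigma ,$$ where $\nabla^*\nabla\sigma=-\operatorname{trace}(\nabla^2\sigma)$, $\Delta=-\operatorname{div}\nabla$ is the Laplacian on functions (non-negative spectrum), $X(\sigma)=\nabla\big(\tfrac{|\sigma|^2}{2}\big)$ is the gradient of $|\sigma|^2/2$, and $|\nabla\sigma|^2=\sum_i|\nabla_{e_i}\sigma|^2$ for a local orthonormal frame $\{e_i\}$. *)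

theory Defs
  imports "HOL-Analysis.Analysis"
begin

section \<open>Differential geometry of embedded submanifolds\<close>

text \<open>
  The definitions below are for a smooth embedded submanifold \<open>M\<close> of a Euclidean space with the
  Riemannian metric induced by the ambient inner product; the round unit sphere
  \<open>sphere 0 1\<close> is such a manifold. Functions and vector fields on \<open>M\<close> are represented by
  total functions on the ambient space. Only their values on \<open>M\<close> are relevant.
\<close>

subsection \<open>Smooth functions, tangent vectors, vector fields\<close>

text \<open>\<open>C\<^sup>k\<close> on an open set \<open>U\<close>: the directional derivatives in all fixed directions are \<open>C\<^sup>k\<^sup>-\<^sup>1\<close>.\<close>

primrec Ck_on :: "nat \<Rightarrow> 'a::euclidean_space set \<Rightarrow> ('a \<Rightarrow> 'b::real_normed_vector) \<Rightarrow> bool" where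
  "Ck_on 0 U f \<longleftrightarrow> continuous_on U f"
| "Ck_on (Suc k) U f \<longleftrightarrow>
     (\<forall>x\<in>U. f differentiable (at x)) \<and> (\<forall>v. Ck_on k U (\<lambda>x. frechet_derivative f (at x) v))"

definition smooth_fun :: "'a::euclidean_space set \<Rightarrow> ('a \<Rightarrow> 'b::real_normed_vector) \<Rightarrow> bool" where
  "smooth_fun M f \<longleftrightarrow>
     (\<exists>U F. open U \<and> M \<subseteq> U \<and> (\<forall>k. Ck_on k U F) \<and> (\<forall>x\<in>M. F x = f x))"

definition tangent_space :: "'a::euclidean_space set \<Rightarrow> 'a \<Rightarrow> 'a set" where
  "tangent_space M x =
     {v. \<exists>\<gamma>. \<gamma> 0 = x \<and> (\<forall>t. \<gamma> t \<in> M) \<and> (\<gamma> has_vector_derivative v) (at (0::real))}"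

definition vector_field :: "'a::euclidean_space set \<Rightarrow> ('a \<Rightarrow> 'a) \<Rightarrow> bool" where
  "vector_field M X \<longleftrightarrow> smooth_fun M X \<and> (\<forall>x\<in>M. X x \<in> tangent_space M x)"

text \<open>
  The derivative at \<open>x\<close> in direction \<open>v\<close> of a (vector-valued) function on \<open>M\<close>. A derivative at
  \<open>x\<close> \<^emph>\<open>within\<close> \<open>M\<close> is not unique as a linear map of the ambient space, but its values on
  \<open>tangent_space M x\<close> are; \<open>dderiv\<close> is used for tangent \<open>v\<close> only.
\<close>

definition dderiv ::
  "'a::euclidean_space set \<Rightarrow> ('a \<Rightarrow> 'b::real_normed_vector) \<Rightarrow> 'a \<Rightarrow> 'a \<Rightarrow> 'b" where
  "dderiv M f x v = frechet_derivative f (at x within M) v"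

text \<open>
  The Lie bracket \<open>[X, Y] = X(Y) - Y(X)\<close>, computed componentwise in the ambient Euclidean space.
\<close>

definition lie_bracket :: "'a::euclidean_space set \<Rightarrow> ('a \<Rightarrow> 'a) \<Rightarrow> ('a \<Rightarrow> 'a) \<Rightarrow> 'a \<Rightarrow> 'a" where
  "lie_bracket M X Y x = dderiv M Y x (X x) - dderiv M X x (Y x)"

text \<open>\<open>lie_metric M \<sigma> X Y\<close> is \<open>(L\<^sub>\<sigma> g)(X, Y)\<close>, the Lie derivative of the metric.\<close>

definition lie_metric ::
  "'a::euclidean_space set \<Rightarrow> ('a \<Rightarrow> 'a) \<Rightarrow> ('a \<Rightarrow> 'a) \<Rightarrow> ('a \<Rightarrow> 'a) \<Rightarrow> 'a \<Rightarrow> real" where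
  "lie_metric M \<sigma> X Y x =
     dderiv M (\<lambda>y. X y \<bullet> Y y) x (\<sigma> x) - lie_bracket M \<sigma> X x \<bullet> Y x - X x \<bullet> lie_bracket M \<sigma> Y x"

definition killing_field :: "'a::euclidean_space set \<Rightarrow> ('a \<Rightarrow> 'a) \<Rightarrow> bool" where
  "killing_field M \<sigma> \<longleftrightarrow> vector_field M \<sigma> \<and>
     (\<forall>X Y. vector_field M X \<longrightarrow> vector_field M Y \<longrightarrow> (\<forall>x\<in>M. lie_metric M \<sigma> X Y x = 0))"


subsection \<open>The Levi-Civita connection\<close>

text \<open>\<open>D X Y\<close> stands for \<open>\<nabla>\<^sub>X Y\<close>.\<close>

definition is_connection ::
  "'a::euclidean_space set \<Rightarrow> (('a \<Rightarrow> 'a) \<Rightarrow> ('a \<Rightarrow> 'a) \<Rightarrow> ('a \<Rightarrow> 'a)) \<Rightarrow> bool" where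
  "is_connection M D \<longleftrightarrow>
     (\<forall>X Y. vector_field M X \<longrightarrow> vector_field M Y \<longrightarrow> vector_field M (D X Y)) \<and>
     (\<forall>X X' Y. vector_field M X \<longrightarrow> vector_field M X' \<longrightarrow> vector_field M Y \<longrightarrow>
        (\<forall>x\<in>M. D (\<lambda>y. X y + X' y) Y x = D X Y x + D X' Y x)) \<and>
     (\<forall>(f :: 'a \<Rightarrow> real) X Y. smooth_fun M f \<longrightarrow> vector_field M X \<longrightarrow> vector_field M Y \<longrightarrow>
        (\<forall>x\<in>M. D (\<lambda>y. f y *\<^sub>R X y) Y x = f x *\<^sub>R D X Y x)) \<and>
     (\<forall>X Y Y'. vector_field M X \<longrightarrow> vector_field M Y \<longrightarrow> vector_field M Y' \<longrightarrow>
        (\<forall>x\<in>M. D X (\<lambda>y. Y y + Y' y) x = D X Y x + D X Y' x)) \<and>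
     (\<forall>(f :: 'a \<Rightarrow> real) X Y. smooth_fun M f \<longrightarrow> vector_field M X \<longrightarrow> vector_field M Y \<longrightarrow>
        (\<forall>x\<in>M. D X (\<lambda>y. f y *\<^sub>R Y y) x = dderiv M f x (X x) *\<^sub>R Y x + f x *\<^sub>R D X Y x))"

definition is_levi_civita ::
  "'a::euclidean_space set \<Rightarrow> (('a \<Rightarrow> 'a) \<Rightarrow> ('a \<Rightarrow> 'a) \<Rightarrow> ('a \<Rightarrow> 'a)) \<Rightarrow> bool" where
  "is_levi_civita M D \<longleftrightarrow> is_connection M D \<and>
     (\<forall>X Y. vector_field M X \<longrightarrow> vector_field M Y \<longrightarrow>
        (\<forall>x\<in>M. D X Y x - D Y X x = lie_bracket M X Y x)) \<and>
     (\<forall>X Y Z. vector_field M X \<longrightarrow> vector_field M Y \<longrightarrow> vector_field M Z \<longrightarrow>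
        (\<forall>x\<in>M. dderiv M (\<lambda>y. Y y \<bullet> Z y) x (X x) = D X Y x \<bullet> Z x + Y x \<bullet> D X Z x))"

text \<open>
  The choice concerns only irrelevant values (off \<open>M\<close>, or on arguments that are not vector fields):
  see \<open>is_levi_civita_nabla_sphere\<close> and \<open>is_levi_civita_sphere_unique\<close> below.
\<close>

definition nabla ::
  "'a::euclidean_space set \<Rightarrow> ('a \<Rightarrow> 'a) \<Rightarrow> ('a \<Rightarrow> 'a) \<Rightarrow> ('a \<Rightarrow> 'a)" where
  "nabla M = (SOME D. is_levi_civita M D)"


subsection \<open>Differential operators and harmonicity\<close>

text \<open>
  Traces at \<open>x\<close> are taken over vector fields on \<open>M\<close> whose values at \<open>x\<close> form an orthonormal basis
  of the tangent space. Orthonormality at \<open>x\<close> suffices, because the expressions summed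
  below are tensorial: they depend on the values at \<open>x\<close> of the frame fields only.
  (A global orthonormal frame need not exist, and does not exist on the 2-sphere.)
\<close>

definition is_frame_at :: "'a::euclidean_space set \<Rightarrow> 'a \<Rightarrow> ('a \<Rightarrow> 'a) set \<Rightarrow> bool" where
  "is_frame_at M x E \<longleftrightarrow>
     finite E \<and> (\<forall>V\<in>E. vector_field M V) \<and>
     (\<forall>V\<in>E. \<forall>W\<in>E. V x \<bullet> W x = (if V = W then 1 else 0)) \<and>
     span ((\<lambda>V. V x) ` E) = tangent_space M x"

definition frame_at :: "'a::euclidean_space set \<Rightarrow> 'a \<Rightarrow> ('a \<Rightarrow> 'a) set" where
  "frame_at M x = (SOME E. is_frame_at M x E)"

definition nabla2 ::
  "'a::euclidean_space set \<Rightarrow> ('a \<Rightarrow> 'a) \<Rightarrow> ('a \<Rightarrow> 'a) \<Rightarrow> ('a \<Rightarrow> 'a) \<Rightarrow> 'a \<Rightarrow> 'a" where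
  "nabla2 M X Y \<sigma> x = nabla M X (nabla M Y \<sigma>) x - nabla M (nabla M X Y) \<sigma> x"

definition rough_laplacian :: "'a::euclidean_space set \<Rightarrow> ('a \<Rightarrow> 'a) \<Rightarrow> 'a \<Rightarrow> 'a" where
  "rough_laplacian M \<sigma> x = - (\<Sum>V\<in>frame_at M x. nabla2 M V V \<sigma> x)"

definition nabla_norm_sq :: "'a::euclidean_space set \<Rightarrow> ('a \<Rightarrow> 'a) \<Rightarrow> 'a \<Rightarrow> real" where
  "nabla_norm_sq M \<sigma> x = (\<Sum>V\<in>frame_at M x. (norm (nabla M V \<sigma> x))\<^sup>2)"

definition gradient :: "'a::euclidean_space set \<Rightarrow> ('a \<Rightarrow> real) \<Rightarrow> 'a \<Rightarrow> 'a" where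
  "gradient M f x =
     (THE w. w \<in> tangent_space M x \<and> (\<forall>v\<in>tangent_space M x. w \<bullet> v = dderiv M f x v))"

definition divergence :: "'a::euclidean_space set \<Rightarrow> ('a \<Rightarrow> 'a) \<Rightarrow> 'a \<Rightarrow> real" where
  "divergence M X x = (\<Sum>V\<in>frame_at M x. nabla M V X x \<bullet> V x)"

text \<open>The sign makes the spectrum of the Laplacian non-negative.\<close>

definition laplacian :: "'a::euclidean_space set \<Rightarrow> ('a \<Rightarrow> real) \<Rightarrow> 'a \<Rightarrow> real" where
  "laplacian M f x = - divergence M (gradient M f) x"

definition half_norm_sq :: "('a::euclidean_space \<Rightarrow> 'a) \<Rightarrow> 'a \<Rightarrow> real" where
  "half_norm_sq \<sigma> x = (norm (\<sigma> x))\<^sup>2 / 2"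

definition X_field :: "'a::euclidean_space set \<Rightarrow> ('a \<Rightarrow> 'a) \<Rightarrow> 'a \<Rightarrow> 'a" where
  "X_field M \<sigma> = gradient M (half_norm_sq \<sigma>)"

definition pq_harmonic ::
  "'a::euclidean_space set \<Rightarrow> real \<Rightarrow> real \<Rightarrow> ('a \<Rightarrow> 'a) \<Rightarrow> bool" where
  "pq_harmonic M p q \<sigma> \<longleftrightarrow> vector_field M \<sigma> \<and>
     (\<forall>x\<in>M. (1 + (norm (\<sigma> x))\<^sup>2) *\<^sub>R rough_laplacian M \<sigma> x
              + (2 * p) *\<^sub>R nabla M (X_field M \<sigma>) \<sigma> x
            = (p * nabla_norm_sq M \<sigma> x - p * q * (norm (X_field M \<sigma> x))\<^sup>2
               - q * (1 + (norm (\<sigma> x))\<^sup>2) * laplacian M (half_norm_sq \<sigma>) x) *\<^sub>R \<sigma> x)"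


section \<open>Existence and uniqueness on the unit sphere\<close>

text \<open>
  The definitions of \<open>nabla\<close> and \<open>frame_at\<close> use \<open>SOME\<close>. On the unit sphere, a Levi-Civita
  connection exists and is unique, and frames exist.
\<close>

lemma tangent_space_sphere:
  assumes "x \<in> sphere 0 1"
  shows "tangent_space (sphere 0 1) x = {v. x \<bullet> v = 0}"
proof (intro set_eqI iffI)
  fix v assume "v \<in> tangent_space (sphere 0 1) x"
  then obtain \<gamma> where g: "\<gamma> 0 = x" "\<And>t. \<gamma> t \<in> sphere 0 1"
      "(\<gamma> has_vector_derivative v) (at (0::real))"
    unfolding tangent_space_def by blast
  have "((\<lambda>t. \<gamma> t \<bullet> \<gamma> t) has_vector_derivative (\<gamma> 0 \<bullet> v + v \<bullet> \<gamma> 0)) (at 0)"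
    by (rule bounded_bilinear.has_vector_derivative[OF bounded_bilinear_inner g(3) g(3)])
  moreover have "(\<lambda>t. \<gamma> t \<bullet> \<gamma> t) = (\<lambda>t. 1)"
    using g(2) by (simp add: dot_square_norm)
  moreover have "((\<lambda>t. 1::real) has_vector_derivative 0) (at (0::real))"
    by simp
  ultimately have "\<gamma> 0 \<bullet> v + v \<bullet> \<gamma> 0 = 0"
    using vector_derivative_unique_at by metis
  then show "v \<in> {v. x \<bullet> v = 0}" using g(1) by (simp add: inner_commute)
next
  fix v assume "v \<in> {v. x \<bullet> v = 0}"
  then have xv: "x \<bullet> v = 0" by simp
  have x1: "x \<bullet> x = 1" using assms by (simp add: dot_square_norm)
  define n where "n = norm v"
  show "v \<in> tangent_space (sphere 0 1) x"
  proof (cases "v = 0")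
    case True
    then show ?thesis using assms unfolding tangent_space_def
      by (auto intro!: exI[of _ "\<lambda>t. x"])
  next
    case False
    then have n: "n > 0" by (simp add: n_def)
    define \<gamma> where "\<gamma> = (\<lambda>t::real. cos (n * t) *\<^sub>R x + (sin (n * t) / n) *\<^sub>R v)"
    have vv: "v \<bullet> v = n\<^sup>2" by (simp add: n_def dot_square_norm)
    have "\<gamma> t \<bullet> \<gamma> t = 1" for t
    proof -
      have "\<gamma> t \<bullet> \<gamma> t = (cos (n * t))\<^sup>2 + (sin (n * t) / n)\<^sup>2 * n\<^sup>2"
        unfolding \<gamma>_def using xv x1 vv
        by (simp add: inner_add_left inner_add_right inner_commute power2_eq_square)
      also have "\<dots> = 1" using n by (simp add: power_divide)
      finally show ?thesis .
    qed
    then have "\<And>t. \<gamma> t \<in> sphere 0 1" by (simp add: norm_eq_1)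
    moreover have "(\<gamma> has_vector_derivative
        (- sin (n * 0) * n) *\<^sub>R x + (cos (n * 0) * n / n) *\<^sub>R v) (at 0)"
      unfolding \<gamma>_def
      by (auto intro!: derivative_eq_intros simp: has_real_derivative_iff_has_vector_derivative[symmetric])
    then have "(\<gamma> has_vector_derivative v) (at 0)" using n by simp
    moreover have "\<gamma> 0 = x" by (simp add: \<gamma>_def)
    ultimately show ?thesis unfolding tangent_space_def by blast
  qed
qed

lemma dderiv_eq:
  assumes f: "(f has_derivative F) (at x within M)" and v: "v \<in> tangent_space M x"
  shows "dderiv M f x v = F v"
proof -
  obtain \<gamma> where g: "\<gamma> 0 = x" "\<And>t. \<gamma> t \<in> M" "(\<gamma> has_vector_derivative v) (at (0::real))"
    using v unfolding tangent_space_def by blast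
  have *: "((f \<circ> \<gamma>) has_vector_derivative G v) (at 0)"
    if "(f has_derivative G) (at x within M)" for G
  proof -
    have "(f has_derivative G) (at (\<gamma> 0) within range \<gamma>)"
      using that g by (auto intro: has_derivative_subset)
    then have "((f \<circ> \<gamma>) has_derivative (G \<circ> (\<lambda>t. t *\<^sub>R v))) (at 0)"
      using g(3) unfolding has_vector_derivative_def by (intro diff_chain_within) auto
    moreover have "G \<circ> (\<lambda>t. t *\<^sub>R v) = (\<lambda>t. t *\<^sub>R G v)"
      using that by (auto simp: linear_simps has_derivative_linear linear_cmul)
    ultimately show ?thesis by (simp add: has_vector_derivative_def)
  qed
  have "(f has_derivative frechet_derivative f (at x within M)) (at x within M)"
    using f frechet_derivative_works differentiable_def by blast
  from vector_derivative_unique_at[OF *[OF this] *[OF f]]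
  show ?thesis by (simp add: dderiv_def)
qed

lemma Ck_on_Suc_D: "Ck_on (Suc k) U f \<Longrightarrow> Ck_on k U f"
proof (induction k arbitrary: f)
  case 0
  then show ?case
    by (auto intro!: continuous_at_imp_continuous_on differentiable_imp_continuous_within)
next
  case (Suc k)
  then show ?case by (metis Ck_on.simps(2))
qed

lemma Ck_on_cong:
  assumes "open U" "\<And>x. x \<in> U \<Longrightarrow> f x = g x" "Ck_on k U f"
  shows "Ck_on k U g"
  using assms(2,3)
proof (induction k arbitrary: f g)
  case 0
  then show ?case by (simp cong: continuous_on_cong)
next
  case (Suc k)
  have d: "g differentiable (at x)" if "x \<in> U" for x
    using Suc.prems assms(1) that
    by (metis Ck_on.simps(2) differentiable_def has_derivative_transform_within_open)
  have "frechet_derivative f (at x) = frechet_derivative g (at x)" if "x \<in> U" for x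
    using frechet_derivative_transform_within_open[of f x U g] Suc.prems assms(1) that by auto
  then have "Ck_on k U (\<lambda>x. frechet_derivative g (at x) v)" for v
    using Suc.IH[of "\<lambda>x. frechet_derivative f (at x) v"] Suc.prems(2) by auto
  with d show ?case by simp
qed

lemma Ck_on_subset: "Ck_on k U f \<Longrightarrow> V \<subseteq> U \<Longrightarrow> Ck_on k V f"
  by (induction k arbitrary: f) (auto intro: continuous_on_subset)

lemma Ck_on_const: "Ck_on k U (\<lambda>x. c)"
  by (induction k arbitrary: c) auto

lemma Ck_on_linear:
  assumes "bounded_linear f" shows "Ck_on k U f"
proof (cases k)
  case 0
  then show ?thesis using assms by (simp add: linear_continuous_on)
next
  case (Suc m)
  have "frechet_derivative f (at x) = f" for x
    using assms bounded_linear_imp_has_derivative frechet_derivative_at by metis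
  then show ?thesis using Suc assms
    by (auto simp: Ck_on_const bounded_linear_imp_differentiable)
qed

lemma Ck_on_add:
  assumes "open U" "Ck_on k U f" "Ck_on k U g"
  shows "Ck_on k U (\<lambda>x. f x + g x)"
  using assms(2,3)
proof (induction k arbitrary: f g)
  case 0
  then show ?case by (auto intro: continuous_intros)
next
  case (Suc k)
  have e: "frechet_derivative (\<lambda>x. f x + g x) (at x) v
      = frechet_derivative f (at x) v + frechet_derivative g (at x) v" if "x \<in> U" for x v
  proof -
    have "((\<lambda>x. f x + g x) has_derivative
       (\<lambda>v. frechet_derivative f (at x) v + frechet_derivative g (at x) v)) (at x)"
      using Suc.prems that by (intro has_derivative_add) (auto simp: frechet_derivative_works)
    from frechet_derivative_at[OF this] show ?thesis by metis
  qed
  have "Ck_on k U (\<lambda>x. frechet_derivative (\<lambda>x. f x + g x) (at x) v)" for v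
    by (rule Ck_on_cong[OF assms(1), rotated, OF Suc.IH[of "\<lambda>x. frechet_derivative f (at x) v"
           "\<lambda>x. frechet_derivative g (at x) v"]])
       (use e Suc.prems in auto)
  then show ?case using Suc.prems by auto
qed

lemma Ck_on_bilinear:
  assumes B: "bounded_bilinear B" and "open U" "Ck_on k U f" "Ck_on k U g"
  shows "Ck_on k U (\<lambda>x. B (f x) (g x))"
  using assms(3,4)
proof (induction k arbitrary: f g)
  case 0
  then show ?case using bounded_bilinear.continuous_on[OF B] by auto
next
  case (Suc k)
  have h: "((\<lambda>x. B (f x) (g x)) has_derivative
       (\<lambda>v. B (f x) (frechet_derivative g (at x) v) + B (frechet_derivative f (at x) v) (g x))) (at x)"
      if "x \<in> U" for x
    using Suc.prems that
    by (intro bounded_bilinear.FDERIV[OF B]) (auto simp: frechet_derivative_works)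
  have e: "B (f x) (frechet_derivative g (at x) v) + B (frechet_derivative f (at x) v) (g x)
       = frechet_derivative (\<lambda>x. B (f x) (g x)) (at x) v" if "x \<in> U" for x v
    using frechet_derivative_at[OF h[OF that]] by metis
  have "Ck_on k U (\<lambda>x. frechet_derivative (\<lambda>x. B (f x) (g x)) (at x) v)" for v
  proof (rule Ck_on_cong[OF assms(2) e])
    show "Ck_on k U (\<lambda>x. B (f x) (frechet_derivative g (at x) v) + B (frechet_derivative f (at x) v) (g x))"
      using Suc.prems by (intro Ck_on_add[OF assms(2)] Suc.IH) (auto intro: Ck_on_Suc_D)
  qed
  then show ?case using h by (auto simp: differentiable_def)
qed

lemma Ck_on_sum:
  assumes "open U" "\<And>i. i \<in> I \<Longrightarrow> Ck_on k U (f i)"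
  shows "Ck_on k U (\<lambda>x. \<Sum>i\<in>I. f i x)"
  using assms(2) by (induction I rule: infinite_finite_induct) (auto simp: Ck_on_const Ck_on_add[OF assms(1)])

lemma Ck_on_frechet_derivative:
  assumes "open U" "Ck_on (Suc k) U f" "Ck_on k U g"
  shows "Ck_on k U (\<lambda>x. frechet_derivative f (at x) (g x))"
proof (rule Ck_on_cong[OF assms(1)])
  show "Ck_on k U (\<lambda>x. \<Sum>b\<in>Basis. (g x \<bullet> b) *\<^sub>R frechet_derivative f (at x) b)"
    using assms
    by (intro Ck_on_sum Ck_on_bilinear[OF bounded_bilinear_scaleR]
              Ck_on_bilinear[OF bounded_bilinear_inner] Ck_on_const) auto
  fix x assume "x \<in> U"
  then have l: "linear (frechet_derivative f (at x))"
    using assms(2) by (simp add: linear_frechet_derivative)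
  have "frechet_derivative f (at x) (\<Sum>b\<in>Basis. (g x \<bullet> b) *\<^sub>R b)
      = (\<Sum>b\<in>Basis. (g x \<bullet> b) *\<^sub>R frechet_derivative f (at x) b)"
    by (simp add: linear_sum[OF l] linear_cmul[OF l])
  then show "(\<Sum>b\<in>Basis. (g x \<bullet> b) *\<^sub>R frechet_derivative f (at x) b)
      = frechet_derivative f (at x) (g x)"
    by (simp add: euclidean_representation)
qed

lemma smooth_funE:
  assumes "smooth_fun M f"
  obtains U F where "open U" "M \<subseteq> U" "\<And>k. Ck_on k U F" "\<And>x. x \<in> M \<Longrightarrow> F x = f x"
  using assms unfolding smooth_fun_def by blast

lemma smooth_fun_bilinear:
  assumes B: "bounded_bilinear B" and "smooth_fun M f" "smooth_fun M g"
  shows "smooth_fun M (\<lambda>x. B (f x) (g x))"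
proof -
  obtain U F where 1: "open U" "M \<subseteq> U" "\<And>k. Ck_on k U F" "\<And>x. x \<in> M \<Longrightarrow> F x = f x"
    using assms(2) smooth_funE by blast
  obtain V G where 2: "open V" "M \<subseteq> V" "\<And>k. Ck_on k V G" "\<And>x. x \<in> M \<Longrightarrow> G x = g x"
    using assms(3) smooth_funE by blast
  have "Ck_on k (U \<inter> V) (\<lambda>x. B (F x) (G x))" for k
    using Ck_on_subset[OF 1(3), of "U \<inter> V"] Ck_on_subset[OF 2(3), of "U \<inter> V"] 1(1) 2(1)
    by (intro Ck_on_bilinear[OF B]) auto
  then show ?thesis unfolding smooth_fun_def using 1 2
    by (intro exI[of _ "U \<inter> V"] exI[of _ "\<lambda>x. B (F x) (G x)"]) auto
qed

lemma smooth_fun_add: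
  assumes "smooth_fun M f" "smooth_fun M g"
  shows "smooth_fun M (\<lambda>x. f x + g x)"
proof -
  obtain U F where 1: "open U" "M \<subseteq> U" "\<And>k. Ck_on k U F" "\<And>x. x \<in> M \<Longrightarrow> F x = f x"
    using assms(1) smooth_funE by blast
  obtain V G where 2: "open V" "M \<subseteq> V" "\<And>k. Ck_on k V G" "\<And>x. x \<in> M \<Longrightarrow> G x = g x"
    using assms(2) smooth_funE by blast
  have "Ck_on k (U \<inter> V) (\<lambda>x. F x + G x)" for k
    using Ck_on_subset[OF 1(3), of "U \<inter> V"] Ck_on_subset[OF 2(3), of "U \<inter> V"] 1(1) 2(1)
    by (intro Ck_on_add) auto
  then show ?thesis unfolding smooth_fun_def using 1 2
    by (intro exI[of _ "U \<inter> V"] exI[of _ "\<lambda>x. F x + G x"]) auto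
qed

lemma smooth_fun_const: "smooth_fun M (\<lambda>x. c)"
  unfolding smooth_fun_def by (intro exI[of _ UNIV] exI[of _ "\<lambda>x. c"]) (auto simp: Ck_on_const)

lemma smooth_fun_id: "smooth_fun M (\<lambda>x. x)"
  unfolding smooth_fun_def
  by (intro exI[of _ UNIV] exI[of _ "\<lambda>x. x"]) (auto intro!: Ck_on_linear bounded_linear_ident)

lemma smooth_fun_has_derivative:
  assumes "smooth_fun M f" "x \<in> M"
  shows "(f has_derivative frechet_derivative f (at x within M)) (at x within M)"
proof -
  obtain U F where 1: "open U" "M \<subseteq> U" "\<And>k. Ck_on k U F" "\<And>x. x \<in> M \<Longrightarrow> F x = f x"
    using assms(1) smooth_funE by blast
  have "F differentiable (at x)" using 1(3)[of "Suc 0"] 1(2) assms(2) by auto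
  then have "F differentiable (at x within M)" by (rule differentiable_at_withinI)
  then obtain G where "(F has_derivative G) (at x within M)" by (auto simp: differentiable_def)
  then have "(f has_derivative G) (at x within M)"
    using 1(4) assms(2) by (rule_tac has_derivative_transform) auto
  then show ?thesis using differentiable_def frechet_derivative_works by blast
qed

lemma smooth_fun_dderiv:
  assumes "smooth_fun M f" "vector_field M X"
  shows "smooth_fun M (\<lambda>x. dderiv M f x (X x))"
proof -
  obtain U F where 1: "open U" "M \<subseteq> U" "\<And>k. Ck_on k U F" "\<And>x. x \<in> M \<Longrightarrow> F x = f x"
    using assms(1) smooth_funE by blast
  obtain V G where 2: "open V" "M \<subseteq> V" "\<And>k. Ck_on k V G" "\<And>x. x \<in> M \<Longrightarrow> G x = X x"
    using assms(2) smooth_funE unfolding vector_field_def by blast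
  have c: "Ck_on k (U \<inter> V) (\<lambda>x. frechet_derivative F (at x) (G x))" for k
    using Ck_on_subset[OF 1(3), of "U \<inter> V"] Ck_on_subset[OF 2(3), of "U \<inter> V"] 1(1) 2(1)
    by (intro Ck_on_frechet_derivative) (auto simp del: Ck_on.simps)
  have "frechet_derivative F (at x) (G x) = dderiv M f x (X x)" if "x \<in> M" for x
  proof -
    have "(F has_derivative frechet_derivative F (at x)) (at x)"
      using 1(3)[of "Suc 0"] 1(2) that by (auto simp: frechet_derivative_works[symmetric])
    then have "(F has_derivative frechet_derivative F (at x)) (at x within M)"
      by (rule has_derivative_at_withinI)
    then have "(f has_derivative frechet_derivative F (at x)) (at x within M)"
      using 1(4) that by (rule_tac has_derivative_transform) auto
    from dderiv_eq[OF this] show ?thesis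
      using assms(2) that 2(4) by (auto simp: vector_field_def)
  qed
  with c show ?thesis unfolding smooth_fun_def using 1 2
    by (intro exI[of _ "U \<inter> V"] exI[of _ "\<lambda>x. frechet_derivative F (at x) (G x)"]) auto
qed

lemma dderiv_bilinear:
  assumes B: "bounded_bilinear B" and "smooth_fun M f" "smooth_fun M g"
    and "x \<in> M" "v \<in> tangent_space M x"
  shows "dderiv M (\<lambda>y. B (f y) (g y)) x v = B (f x) (dderiv M g x v) + B (dderiv M f x v) (g x)"
  unfolding dderiv_def[of M f] dderiv_def[of M g]
  by (rule dderiv_eq, rule bounded_bilinear.FDERIV[OF B]) (use assms smooth_fun_has_derivative in auto)

lemma dderiv_add_fun:
  assumes "smooth_fun M f" "smooth_fun M g" "x \<in> M" "v \<in> tangent_space M x"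
  shows "dderiv M (\<lambda>y. f y + g y) x v = dderiv M f x v + dderiv M g x v"
  unfolding dderiv_def[of M f] dderiv_def[of M g]
  by (rule dderiv_eq, rule has_derivative_add) (use assms smooth_fun_has_derivative in auto)

lemma dderiv_linear:
  assumes "smooth_fun M f" "x \<in> M"
  shows "linear (dderiv M f x)"
  using smooth_fun_has_derivative[OF assms] unfolding dderiv_def[abs_def]
  by (simp add: has_derivative_linear)

text \<open>The tangential part of the ambient derivative; it serves as existence witness only.\<close>

definition sphere_nabla :: "('a::euclidean_space \<Rightarrow> 'a) \<Rightarrow> ('a \<Rightarrow> 'a) \<Rightarrow> 'a \<Rightarrow> 'a" where
  "sphere_nabla X Y x = (let w = dderiv (sphere 0 1) Y x (X x) in w - (x \<bullet> w) *\<^sub>R x)"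

lemma smooth_fun_proj:
  assumes "smooth_fun M w" shows "smooth_fun M (\<lambda>x. w x - (x \<bullet> w x) *\<^sub>R (x::'a::euclidean_space))"
proof -
  have "smooth_fun M (\<lambda>x. w x + (x \<bullet> w x) *\<^sub>R ((-1) *\<^sub>R x))"
    by (intro smooth_fun_add assms smooth_fun_bilinear[OF bounded_bilinear_scaleR]
        smooth_fun_bilinear[OF bounded_bilinear_inner] smooth_fun_const smooth_fun_id)
  then show ?thesis by simp
qed

lemma vector_field_sphere_proj:
  fixes w :: "'a::euclidean_space \<Rightarrow> 'a"
  assumes "smooth_fun (sphere 0 1) w"
  shows "vector_field (sphere 0 1) (\<lambda>x. w x - (x \<bullet> w x) *\<^sub>R x)"
  unfolding vector_field_def
  using smooth_fun_proj[OF assms]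
  by (auto simp: tangent_space_sphere inner_diff_right dot_square_norm)

lemma vector_field_scaleR_sphere:
  assumes "smooth_fun (sphere 0 1) f" "vector_field (sphere 0 1) X"
  shows "vector_field (sphere 0 1) (\<lambda>y. f y *\<^sub>R X y)"
  using assms smooth_fun_bilinear[OF bounded_bilinear_scaleR]
  by (auto simp: vector_field_def tangent_space_sphere)

lemma vector_field_sphere_orth:
  assumes "vector_field (sphere 0 1) X" "x \<in> sphere 0 1"
  shows "x \<bullet> X x = 0" "X x \<bullet> x = 0"
  using assms by (auto simp: vector_field_def tangent_space_sphere inner_commute)

lemma is_levi_civita_sphere_nabla:
  "is_levi_civita (sphere (0::'a::euclidean_space) 1) sphere_nabla"
proof -
  let ?S = "sphere (0::'a) 1"
  note orth = vector_field_sphere_orth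
  have sm: "smooth_fun ?S X" if "vector_field ?S X" for X
    using that by (simp add: vector_field_def)
  have tan: "X x \<in> tangent_space ?S x" if "vector_field ?S X" "x \<in> ?S" for X x
    using that by (simp add: vector_field_def)
  have xx: "x \<bullet> x = 1" if "x \<in> ?S" for x :: 'a
    using that by (simp add: dot_square_norm)
  have vf: "vector_field ?S (sphere_nabla X Y)" if "vector_field ?S X" "vector_field ?S Y" for X Y
    using vector_field_sphere_proj[OF smooth_fun_dderiv[OF sm[OF that(2)] that(1)]]
    unfolding sphere_nabla_def[abs_def] Let_def .
  have norm_part: "x \<bullet> dderiv ?S Y x (X x) = - (Y x \<bullet> X x)"
    if "vector_field ?S X" "vector_field ?S Y" "x \<in> ?S" for X Y x
  proof -
    have "dderiv ?S (\<lambda>y. y \<bullet> Y y) x (X x) = 0"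
    proof (rule dderiv_eq[where F = "\<lambda>_. 0"])
      show "((\<lambda>y. y \<bullet> Y y) has_derivative (\<lambda>_. 0)) (at x within ?S)"
        by (rule has_derivative_transform[where f = "\<lambda>_. 0"]) (use that orth in auto)
    qed (use that tan in auto)
    moreover have "dderiv ?S (\<lambda>y. y) x (X x) = X x"
      by (rule dderiv_eq[where F = "\<lambda>v. v"]) (use that tan in auto)
    ultimately show ?thesis
      using dderiv_bilinear[OF bounded_bilinear_inner smooth_fun_id sm[OF that(2)] that(3) tan[OF that(1,3)]]
      by (simp add: inner_commute)
  qed
  have conn: "is_connection ?S sphere_nabla"
    unfolding is_connection_def
  proof (intro conjI allI impI ballI)
    fix X X' Y :: "'a \<Rightarrow> 'a" and x :: 'a
    assume *: "vector_field ?S X" "vector_field ?S X'" "vector_field ?S Y" "x \<in> ?S"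
    show "sphere_nabla (\<lambda>y. X y + X' y) Y x = sphere_nabla X Y x + sphere_nabla X' Y x"
      by (simp add: sphere_nabla_def Let_def linear_add[OF dderiv_linear[OF sm[OF *(3)] *(4)]]
          algebra_simps)
  next
    fix f :: "'a \<Rightarrow> real" and X Y :: "'a \<Rightarrow> 'a" and x :: 'a
    assume *: "smooth_fun ?S f" "vector_field ?S X" "vector_field ?S Y" "x \<in> ?S"
    show "sphere_nabla (\<lambda>y. f y *\<^sub>R X y) Y x = f x *\<^sub>R sphere_nabla X Y x"
      by (simp add: sphere_nabla_def Let_def linear_cmul[OF dderiv_linear[OF sm[OF *(3)] *(4)]]
          algebra_simps)
  next
    fix X Y Y' :: "'a \<Rightarrow> 'a" and x :: 'a
    assume *: "vector_field ?S X" "vector_field ?S Y" "vector_field ?S Y'" "x \<in> ?S"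
    show "sphere_nabla X (\<lambda>y. Y y + Y' y) x = sphere_nabla X Y x + sphere_nabla X Y' x"
      by (simp add: sphere_nabla_def Let_def
          dderiv_add_fun[OF sm[OF *(2)] sm[OF *(3)] *(4) tan[OF *(1,4)]]
          inner_add_right scaleR_add_left)
  next
    fix f :: "'a \<Rightarrow> real" and X Y :: "'a \<Rightarrow> 'a" and x :: 'a
    assume *: "smooth_fun ?S f" "vector_field ?S X" "vector_field ?S Y" "x \<in> ?S"
    show "sphere_nabla X (\<lambda>y. f y *\<^sub>R Y y) x = dderiv ?S f x (X x) *\<^sub>R Y x + f x *\<^sub>R sphere_nabla X Y x"
      using orth[OF *(3,4)]
      by (simp add: sphere_nabla_def Let_def
          dderiv_bilinear[OF bounded_bilinear_scaleR *(1) sm[OF *(3)] *(4) tan[OF *(2,4)]] algebra_simps)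
  qed (use vf in auto)
  show ?thesis
    unfolding is_levi_civita_def
  proof (intro conjI conn allI impI ballI)
    fix X Y :: "'a \<Rightarrow> 'a" and x :: 'a
    assume *: "vector_field ?S X" "vector_field ?S Y" "x \<in> ?S"
    show "sphere_nabla X Y x - sphere_nabla Y X x = lie_bracket ?S X Y x"
      using norm_part[OF *(1,2,3)] norm_part[OF *(2,1,3)]
      by (simp add: sphere_nabla_def Let_def lie_bracket_def inner_commute)
  next
    fix X Y Z :: "'a \<Rightarrow> 'a" and x :: 'a
    assume *: "vector_field ?S X" "vector_field ?S Y" "vector_field ?S Z" "x \<in> ?S"
    show "dderiv ?S (\<lambda>y. Y y \<bullet> Z y) x (X x) = sphere_nabla X Y x \<bullet> Z x + Y x \<bullet> sphere_nabla X Z x"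
      using orth[OF *(2,4)] orth[OF *(3,4)]
      by (simp add: sphere_nabla_def Let_def inner_diff_left inner_diff_right
          dderiv_bilinear[OF bounded_bilinear_inner sm[OF *(2)] sm[OF *(3)] *(4) tan[OF *(1,4)]])
  qed
qed

theorem is_levi_civita_nabla_sphere:
  "is_levi_civita (sphere (0::'a::euclidean_space) 1) (nabla (sphere 0 1))"
  unfolding nabla_def
  by (rule someI[of "is_levi_civita (sphere 0 1)", OF is_levi_civita_sphere_nabla])

theorem is_levi_civita_sphere_unique:
  fixes D D' :: "('a::euclidean_space \<Rightarrow> 'a) \<Rightarrow> ('a \<Rightarrow> 'a) \<Rightarrow> ('a \<Rightarrow> 'a)"
  assumes D: "is_levi_civita (sphere 0 1) D" and D': "is_levi_civita (sphere 0 1) D'"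
    and "vector_field (sphere 0 1) X" "vector_field (sphere 0 1) Y" "x \<in> sphere 0 1"
  shows "D X Y x = D' X Y x"
proof -
  let ?S = "sphere (0::'a) 1"
  define B where "B X Y Z = (D X Y x - D' X Y x) \<bullet> Z x" for X Y Z
  have 1: "B X Y Z = - B X Z Y"
    if "vector_field ?S X" "vector_field ?S Y" "vector_field ?S Z" for X Y Z
  proof -
    have "dderiv ?S (\<lambda>y. Y y \<bullet> Z y) x (X x) = D X Y x \<bullet> Z x + Y x \<bullet> D X Z x"
      using D assms(5) that unfolding is_levi_civita_def by blast
    moreover have "dderiv ?S (\<lambda>y. Y y \<bullet> Z y) x (X x) = D' X Y x \<bullet> Z x + Y x \<bullet> D' X Z x"
      using D' assms(5) that unfolding is_levi_civita_def by blast
    ultimately show ?thesis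
      by (simp add: B_def inner_diff_left inner_diff_right inner_commute[of "Y x"])
  qed
  have 2: "B X Y Z = B Y X Z" if "vector_field ?S X" "vector_field ?S Y" for X Y Z
  proof -
    have "D X Y x - D Y X x = lie_bracket ?S X Y x"
      using D assms(5) that unfolding is_levi_civita_def by blast
    moreover have "D' X Y x - D' Y X x = lie_bracket ?S X Y x"
      using D' assms(5) that unfolding is_levi_civita_def by blast
    ultimately have "D X Y x - D' X Y x = D Y X x - D' Y X x" by (simp add: algebra_simps)
    then show ?thesis by (simp add: B_def)
  qed
  have B0: "B X Y Z = 0" if "vector_field ?S Z" for Z
    using 1 2 assms(3,4) that by (smt (verit))
  define u where "u = D X Y x - D' X Y x"
  have "vector_field ?S (D X Y)" "vector_field ?S (D' X Y)"
    using D[unfolded is_levi_civita_def is_connection_def, THEN conjunct1, THEN conjunct1]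
      D'[unfolded is_levi_civita_def is_connection_def, THEN conjunct1, THEN conjunct1] assms(3,4)
    by simp_all
  then have "x \<bullet> u = 0"
    using assms(5) by (simp add: u_def inner_diff_right vector_field_sphere_orth)
  moreover have "B X Y (\<lambda>y. u - (y \<bullet> u) *\<^sub>R y) = 0"
    by (rule B0) (rule vector_field_sphere_proj[OF smooth_fun_const])
  ultimately have "u \<bullet> u = 0" by (simp add: B_def u_def[symmetric])
  then show ?thesis by (simp add: u_def)
qed

corollary nabla_sphere_eq:
  fixes X :: "'a::euclidean_space \<Rightarrow> 'a"
  assumes "vector_field (sphere 0 1) X" "vector_field (sphere 0 1) Y" "x \<in> sphere 0 1"
  shows "nabla (sphere 0 1) X Y x = sphere_nabla X Y x"
  using is_levi_civita_sphere_unique[OF is_levi_civita_nabla_sphere is_levi_civita_sphere_nabla]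
    assms by blast

theorem is_frame_at_frame_at_sphere:
  assumes "x \<in> sphere (0::'a::euclidean_space) 1"
  shows "is_frame_at (sphere 0 1) x (frame_at (sphere 0 1) x)"
proof -
  let ?S = "sphere (0::'a) 1"
  have "subspace (tangent_space ?S x)"
    by (simp add: tangent_space_sphere[OF assms] subspace_hyperplane)
  then obtain B where B: "B \<subseteq> tangent_space ?S x" "pairwise orthogonal B"
      "\<And>b. b \<in> B \<Longrightarrow> norm b = 1" "independent B" "span B = tangent_space ?S x"
    using orthonormal_basis_subspace by metis
  define V where "V b = (\<lambda>y. b - (y \<bullet> b) *\<^sub>R y)" for b :: 'a
  have Vx: "V b x = b" if "b \<in> B" for b
    using B(1) that by (auto simp: V_def tangent_space_sphere[OF assms])
  have inj: "b = c" if "b \<in> B" "c \<in> B" "V b = V c" for b c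
    using Vx that by metis
  have "finite B" using B(4) by (rule independent_imp_finite)
  moreover have "(\<lambda>W. W x) ` V ` B = B" using Vx by (force simp: image_image)
  moreover have "vector_field ?S (V b)" for b
    unfolding V_def by (rule vector_field_sphere_proj[OF smooth_fun_const])
  moreover have "b \<bullet> c = (if V b = V c then 1 else 0)" if "b \<in> B" "c \<in> B" for b c
  proof (cases "b = c")
    case True
    then show ?thesis using B(3) that by (simp add: norm_eq_1)
  next
    case False
    then show ?thesis using B(2) inj that by (auto simp: pairwise_def orthogonal_def)
  qed
  ultimately have "is_frame_at ?S x (V ` B)"
    unfolding is_frame_at_def using B(5) Vx by auto
  then show ?thesis unfolding frame_at_def by (rule someI)
qed

end

(* A Killing field has constant inner product with the velocity of a geodesic. Evaluated on a great
   circle through x and y this gives sigma(y).x = - sigma(x).y, so that sigma is the restriction of a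
   skew linear map, and in dimension three sigma(y) = w x y. On the equator orthogonal to w both the
   gradient of |sigma|^2/2 and the covariant derivative of sigma vanish, the rough Laplacian of
   sigma is sigma, and the Laplacian of |sigma|^2/2 is nonnegative because |sigma| is maximal there.
   The inner product of the harmonicity equation with sigma then equates a positive number with a
   nonpositive one. *)

theory Submission
  imports Defs
begin

section \<open>Derivatives and vector fields that depend only on values on the submanifold\<close>

text \<open>A derivative within \<open>M\<close> is a choice among possibly many linear maps.
  Functions that agree on \<open>M\<close> admit exactly the same candidates, so the choice itself
  is the same, even in non-tangent directions.\<close>

lemma dderiv_cong:
  assumes "\<And>y. y \<in> M \<Longrightarrow> f y = g y" "x \<in> M"
  shows "dderiv M f x = dderiv M g x"
proof -
  have "(f has_derivative F) (at x within M) \<longleftrightarrow> (g has_derivative F) (at x within M)" for F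
    using has_derivative_transform[of x M f g F] has_derivative_transform[of x M g f F] assms by auto
  then show ?thesis
    unfolding dderiv_def[abs_def] frechet_derivative_def by simp
qed

lemma smooth_fun_cong:
  assumes "\<And>y. y \<in> M \<Longrightarrow> f y = g y" "smooth_fun M f"
  shows "smooth_fun M g"
proof -
  obtain U F where "open U" "M \<subseteq> U" "\<And>k. Ck_on k U F" "\<And>x. x \<in> M \<Longrightarrow> F x = f x"
    using assms(2) smooth_funE by blast
  then show ?thesis
    unfolding smooth_fun_def using assms(1) by (intro exI[of _ U] exI[of _ F]) simp
qed

lemma vector_field_cong:
  assumes "\<And>y. y \<in> M \<Longrightarrow> X y = Y y" "vector_field M X"
  shows "vector_field M Y"
  using assms smooth_fun_cong[of M X Y] by (simp add: vector_field_def)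

lemma smooth_fun_bounded_linear:
  assumes "bounded_linear f" shows "smooth_fun M f"
  unfolding smooth_fun_def
  by (intro exI[of _ UNIV] exI[of _ f]) (simp add: Ck_on_linear[OF assms])

lemma vector_field_sphere_nabla:
  assumes "vector_field (sphere 0 1) X" "vector_field (sphere 0 1) Y"
  shows "vector_field (sphere 0 1) (nabla (sphere 0 1) X Y)"
  by (rule is_levi_civita_nabla_sphere[unfolded is_levi_civita_def is_connection_def,
        THEN conjunct1, THEN conjunct1, rule_format, OF assms])

text \<open>Differentiating \<open>y \<bullet> Y y = 0\<close> along the sphere gives the normal
  part of the ambient derivative, that is, the second fundamental form.\<close>

lemma dderiv_sphere_radial:
  assumes "vector_field (sphere 0 1) Y" "x \<in> sphere 0 1" "v \<in> tangent_space (sphere 0 1) x"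
  shows "x \<bullet> dderiv (sphere 0 1) Y x v = - (Y x \<bullet> v)"
proof -
  let ?S = "sphere (0::'a) 1"
  have "dderiv ?S (\<lambda>y. y \<bullet> Y y) x v = 0"
  proof (rule dderiv_eq[where F = "\<lambda>_. 0"])
    show "((\<lambda>y. y \<bullet> Y y) has_derivative (\<lambda>_. 0)) (at x within ?S)"
      by (rule has_derivative_transform[where f = "\<lambda>_. 0"])
        (use assms vector_field_sphere_orth in auto)
  qed (use assms in auto)
  moreover have "dderiv ?S (\<lambda>y. y) x v = v"
    by (rule dderiv_eq[where F = "\<lambda>v. v"]) (use assms in auto)
  moreover have "smooth_fun ?S Y"
    using assms by (simp add: vector_field_def)
  ultimately show ?thesis
    using dderiv_bilinear[OF bounded_bilinear_inner smooth_fun_id _ assms(2,3)]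
    by (simp add: inner_commute)
qed

section \<open>Killing fields on the unit sphere are skew linear\<close>

text \<open>The Killing equation is applied to one field \<open>V\<close> in both slots. The
  derivatives of \<open>V\<close> along \<open>\<sigma>\<close> cancel between the metric term and
  the brackets, leaving twice the claimed product.\<close>

lemma killing_field_sphere_dderiv:
  assumes "killing_field (sphere 0 1) \<sigma>" "x \<in> sphere 0 1" "x \<bullet> v = 0"
  shows "dderiv (sphere 0 1) \<sigma> x v \<bullet> v = 0"
proof -
  let ?S = "sphere (0::'a) 1"
  \<comment> \<open>Tangential projection of a constant field: a global vector field with value
    \<open>v\<close> at \<open>x\<close>.\<close>
  define V where "V = (\<lambda>y. v - (y \<bullet> v) *\<^sub>R y)"
  have V: "vector_field ?S V"
    unfolding V_def by (rule vector_field_sphere_proj[OF smooth_fun_const])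
  have Vx: "V x = v" using assms by (simp add: V_def)
  have s: "smooth_fun ?S V" and t: "\<sigma> x \<in> tangent_space ?S x"
    using V assms by (auto simp: killing_field_def vector_field_def)
  have "lie_metric ?S \<sigma> V V x = 0"
    using assms V by (simp add: killing_field_def)
  then show ?thesis
    using dderiv_bilinear[OF bounded_bilinear_inner s s assms(2) t]
    by (simp add: lie_metric_def lie_bracket_def Vx inner_diff_left inner_diff_right inner_commute)
qed

text \<open>Along the great circle the derivative of
  \<open>\<sigma> (\<gamma> t) \<bullet> \<delta> t\<close> has two terms. One vanishes by the
  Killing equation, the other because the acceleration \<open>- \<gamma> t\<close> is normal to the
  sphere.\<close>

lemma killing_field_sphere_geodesic:
  assumes K: "killing_field (sphere 0 1) \<sigma>" and x: "norm x = 1" and u: "norm u = 1"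
    and xu: "x \<bullet> u = 0"
  shows "\<sigma> (cos t *\<^sub>R x + sin t *\<^sub>R u) \<bullet> (cos t *\<^sub>R u - sin t *\<^sub>R x) = \<sigma> x \<bullet> u"
proof -
  let ?S = "sphere (0::'a) 1"
  define \<gamma> where "\<gamma> t = cos t *\<^sub>R x + sin t *\<^sub>R u" for t :: real
  define \<delta> where "\<delta> t = cos t *\<^sub>R u - sin t *\<^sub>R x" for t :: real
  have vf: "vector_field ?S \<sigma>" using K by (simp add: killing_field_def)
  have xx: "x \<bullet> x = 1" "u \<bullet> u = 1" using x u by (simp_all add: dot_square_norm)
  have \<gamma>: "\<gamma> t \<in> ?S" for t
  proof -
    have "\<gamma> t \<bullet> \<gamma> t = (cos t)\<^sup>2 + (sin t)\<^sup>2"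
      using xx xu by (simp add: \<gamma>_def inner_simps inner_commute power2_eq_square)
    then show ?thesis by (simp add: norm_eq_1)
  qed
  have \<gamma>\<delta>: "\<gamma> t \<bullet> \<delta> t = 0" for t
    using xx xu by (simp add: \<gamma>_def \<delta>_def inner_simps inner_commute)
  have d\<gamma>: "(\<gamma> has_vector_derivative \<delta> t) (at t)" for t
    unfolding \<gamma>_def[abs_def] \<delta>_def
    by (auto intro!: derivative_eq_intros simp: has_real_derivative_iff_has_vector_derivative[symmetric])
  have d\<delta>: "(\<delta> has_vector_derivative - \<gamma> t) (at t)" for t
    unfolding \<gamma>_def \<delta>_def[abs_def]
    by (auto intro!: derivative_eq_intros simp: has_real_derivative_iff_has_vector_derivative[symmetric])
  have d\<sigma>: "((\<lambda>t. \<sigma> (\<gamma> t)) has_vector_derivative dderiv ?S \<sigma> (\<gamma> t) (\<delta> t)) (at t)" for t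
  proof -
    let ?D = "dderiv ?S \<sigma> (\<gamma> t)"
    have D: "(\<sigma> has_derivative ?D) (at (\<gamma> t) within ?S)"
      unfolding dderiv_def[abs_def]
      by (rule smooth_fun_has_derivative[OF _ \<gamma>]) (use vf in \<open>simp add: vector_field_def\<close>)
    \<comment> \<open>\<open>\<sigma>\<close> is differentiable only within the sphere, so the chain
      rule is used on the image of the curve.\<close>
    then have "(\<sigma> has_derivative ?D) (at (\<gamma> t) within range \<gamma>)"
      using \<gamma> by (auto intro: has_derivative_subset)
    then have "((\<sigma> \<circ> \<gamma>) has_derivative (?D \<circ> (\<lambda>s. s *\<^sub>R \<delta> t))) (at t)"
      using d\<gamma> unfolding has_vector_derivative_def by (intro diff_chain_within) auto
    moreover have "?D \<circ> (\<lambda>s. s *\<^sub>R \<delta> t) = (\<lambda>s. s *\<^sub>R ?D (\<delta> t))"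
      using D by (auto simp: has_derivative_linear linear_cmul)
    ultimately show ?thesis by (simp add: has_vector_derivative_def o_def)
  qed
  have "((\<lambda>t. \<sigma> (\<gamma> t) \<bullet> \<delta> t) has_vector_derivative 0) (at t)" for t
    using bounded_bilinear.has_vector_derivative[OF bounded_bilinear_inner d\<sigma> d\<delta>]
      killing_field_sphere_dderiv[OF K \<gamma> \<gamma>\<delta>] vector_field_sphere_orth[OF vf \<gamma>] by simp
  then obtain c where "\<And>t. \<sigma> (\<gamma> t) \<bullet> \<delta> t = c"
    using has_vector_derivative_zero_constant[of UNIV "\<lambda>t. \<sigma> (\<gamma> t) \<bullet> \<delta> t"] by auto
  then have "\<sigma> (\<gamma> t) \<bullet> \<delta> t = \<sigma> (\<gamma> 0) \<bullet> \<delta> 0" by metis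
  then show ?thesis by (simp add: \<gamma>_def \<delta>_def)
qed

text \<open>The conserved product is compared at \<open>x\<close> and at \<open>y\<close> on a great
  circle through both. With \<open>a = cos t\<close> and \<open>b = sin t\<close>, the velocity at
  \<open>y\<close> satisfies \<open>b * velocity = a * y - x\<close>, and \<open>\<sigma> y\<close>
  is orthogonal to \<open>y\<close>.\<close>

lemma killing_field_sphere_skew:
  assumes K: "killing_field (sphere 0 1) \<sigma>" and x: "x \<in> sphere 0 1" and y: "y \<in> sphere 0 1"
  shows "\<sigma> y \<bullet> x = - (\<sigma> x \<bullet> y)"
proof -
  let ?S = "sphere (0::'a) 1"
  have vf: "vector_field ?S \<sigma>" using K by (simp add: killing_field_def)
  note o = vector_field_sphere_orth(2)[OF vf x] vector_field_sphere_orth(2)[OF vf y]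
  have xx: "x \<bullet> x = 1" "y \<bullet> y = 1" using x y by (simp_all add: dot_square_norm)
  define a where "a = x \<bullet> y"
  define b where "b = norm (y - a *\<^sub>R x)"
  have b2: "b\<^sup>2 = 1 - a\<^sup>2"
    unfolding b_def power2_norm_eq_inner
    using xx by (simp add: inner_simps a_def inner_commute power2_eq_square)
  show ?thesis
  proof (cases "b = 0")
    case True
    \<comment> \<open>Here \<open>y\<close> is \<open>x\<close> or its antipode, no great circle is
      singled out, and both sides vanish.\<close>
    then have ya: "y = a *\<^sub>R x" by (simp add: b_def)
    moreover have "a \<noteq> 0" using b2 True by auto
    ultimately show ?thesis using o by simp
  next
    case False
    define u where "u = (1 / b) *\<^sub>R (y - a *\<^sub>R x)"
    have u: "norm u = 1" using False by (simp add: u_def b_def)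
    have xu: "x \<bullet> u = 0" using xx by (simp add: u_def a_def inner_simps)
    have yu: "y = a *\<^sub>R x + b *\<^sub>R u" using False by (simp add: u_def)
    have "a\<^sup>2 + b\<^sup>2 = 1" using b2 by simp
    then obtain t where t: "a = cos t" "b = sin t" using sincos_total_2pi by metis
    have "\<sigma> y \<bullet> (a *\<^sub>R u - b *\<^sub>R x) = \<sigma> x \<bullet> u"
      using killing_field_sphere_geodesic[OF K _ u xu, of t] x yu t by simp
    \<comment> \<open>Multiplying by \<open>b\<close> allows \<open>u\<close> to be eliminated in
      favour of \<open>y - a *\<^sub>R x\<close>.\<close>
    from arg_cong[OF this, of "\<lambda>c. b * c"]
    have "\<sigma> y \<bullet> (a *\<^sub>R (b *\<^sub>R u) - b\<^sup>2 *\<^sub>R x) = \<sigma> x \<bullet> (b *\<^sub>R u)"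
      by (simp add: inner_diff_right power2_eq_square algebra_simps)
    moreover have "b *\<^sub>R u = y - a *\<^sub>R x" using yu by (simp add: algebra_simps)
    ultimately have "\<sigma> y \<bullet> (a *\<^sub>R (y - a *\<^sub>R x) - (1 - a\<^sup>2) *\<^sub>R x) = \<sigma> x \<bullet> (y - a *\<^sub>R x)"
      using b2 by simp
    then show ?thesis
      using o by (simp add: inner_diff_right power2_eq_square algebra_simps)
  qed
qed

text \<open>Skewness against the basis vectors expresses each coordinate of
  \<open>\<sigma> y\<close> linearly in \<open>y\<close>, with a skew 3 by 3 matrix. Its columns are
  the values of \<open>\<sigma>\<close> at the basis vectors, and the axis \<open>w\<close> is read
  off from its entries.\<close>

lemma killing_field_sphere_eq_cross3:
  fixes \<sigma> :: "real ^ 3 \<Rightarrow> real ^ 3"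
  assumes K: "killing_field (sphere 0 1) \<sigma>"
  obtains w where "\<And>y. y \<in> sphere 0 1 \<Longrightarrow> \<sigma> y = cross3 w y"
proof -
  let ?e = "\<lambda>i. axis i 1 :: real ^ 3"
  define w :: "real ^ 3" where "w = vector [\<sigma> (?e 2) $ 3, - (\<sigma> (?e 1) $ 3), \<sigma> (?e 1) $ 2]"
  have e: "?e i \<in> sphere 0 1" for i by simp
  have entry: "\<sigma> y $ i = - (\<sigma> (?e i) \<bullet> y)" if "y \<in> sphere 0 1" for y i
    using killing_field_sphere_skew[OF K e that, of i] by (simp add: inner_axis)
  have sk: "\<sigma> (?e j) $ i = - (\<sigma> (?e i) $ j)" for i j
    using entry[OF e, of j i] by (simp add: inner_axis)
  have diag: "\<sigma> (?e i) $ i = 0" for i using sk[of i i] by simp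
  have "\<sigma> y = cross3 w y" if "y \<in> sphere 0 1" for y
  proof -
    have y: "\<sigma> y $ i = - (\<sigma> (?e i) $ 1 * y $ 1 + \<sigma> (?e i) $ 2 * y $ 2 + \<sigma> (?e i) $ 3 * y $ 3)" for i
      using entry[of y i] that by (simp add: inner_vec_def sum_3)
    show ?thesis
      unfolding vec_eq_iff forall_3 y
      by (simp add: cross3_def w_def diag sk[of 2 1] sk[of 3 1] sk[of 3 2])
  qed
  then show thesis by (rule that)
qed

section \<open>Covariant calculus of skew linear fields on spheres of any dimension\<close>

text \<open>\<open>A\<close> is linear on the whole space and stands in for \<open>\<sigma>\<close>
  in ambient derivatives.\<close>

locale skew_linear_field =
  fixes A :: "'a::euclidean_space \<Rightarrow> 'a" and \<sigma> :: "'a \<Rightarrow> 'a"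
  assumes linear: "linear A" and skew: "A y \<bullet> y = 0"
    and eq: "y \<in> sphere 0 1 \<Longrightarrow> \<sigma> y = A y"
begin

abbreviation S :: "'a set" where "S \<equiv> sphere 0 1"

lemma bounded_linear_A: "bounded_linear A"
  using linear by (rule linear_conv_bounded_linear[THEN iffD1])

text \<open>Polarization of the quadratic identity \<open>skew\<close>.\<close>

lemma inner_skew: "y \<bullet> A z = - (A y \<bullet> z)"
  using skew[of "y + z"] skew[of y] skew[of z]
  by (simp add: linear_add[OF linear] inner_simps inner_commute)

lemma vector_field: "vector_field S \<sigma>"
  by (rule vector_field_cong[of S A])
    (use eq smooth_fun_bounded_linear[OF bounded_linear_A] skew in
      \<open>auto simp: vector_field_def tangent_space_sphere inner_commute\<close>)

text \<open>The ambient derivative of \<open>A\<close> is \<open>A\<close>; the second summand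
  removes the normal component, rewritten by skewness.\<close>

lemma nabla_eq:
  assumes "vector_field S V" "x \<in> S"
  shows "nabla S V \<sigma> x = A (V x) + (A x \<bullet> V x) *\<^sub>R x"
proof -
  have "dderiv S \<sigma> x (V x) = dderiv S A x (V x)"
    using dderiv_cong[of S \<sigma> A x] eq assms by simp
  also have "\<dots> = A (V x)"
    by (rule dderiv_eq[OF bounded_linear_imp_has_derivative[OF bounded_linear_A]])
      (use assms in \<open>auto simp: vector_field_def\<close>)
  finally show ?thesis
    using inner_skew[of x "V x"]
    by (simp add: nabla_sphere_eq[OF assms(1) vector_field assms(2)] sphere_nabla_def)
qed

text \<open>The derivative \<open>d\<close> of \<open>V\<close> occurs in both terms of
  \<open>nabla2\<close> and cancels. What remains is the curvature of the unit sphere, as for every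
  Killing field.\<close>

lemma nabla2_eq:
  assumes V: "vector_field S V" and x: "x \<in> S"
  shows "nabla2 S V V \<sigma> x = (A x \<bullet> V x) *\<^sub>R V x - (V x \<bullet> V x) *\<^sub>R A x"
proof -
  define d where "d = dderiv S V x (V x)"
  have sV: "smooth_fun S V" and tV: "V x \<in> tangent_space S x"
    using V x by (auto simp: vector_field_def)
  have xV: "x \<bullet> V x = 0" "V x \<bullet> x = 0" "x \<bullet> x = 1"
    using vector_field_sphere_orth[OF V x] x by (simp_all add: dot_square_norm)
  have xd: "x \<bullet> d = - (V x \<bullet> V x)"
    unfolding d_def by (rule dderiv_sphere_radial[OF V x tV])
  have dV: "(V has_derivative dderiv S V x) (at x within S)"
    unfolding dderiv_def[abs_def] using smooth_fun_has_derivative[OF sV x] .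
  have "((\<lambda>y. A (V y) + (A y \<bullet> V y) *\<^sub>R y) has_derivative
      (\<lambda>h. A (dderiv S V x h) + ((A x \<bullet> V x) *\<^sub>R h + (A x \<bullet> dderiv S V x h + A h \<bullet> V x) *\<^sub>R x)))
      (at x within S)"
    by (intro derivative_intros bounded_linear.has_derivative[OF bounded_linear_A] dV)
  from dderiv_eq[OF this tV]
  have "dderiv S (nabla S V \<sigma>) x (V x)
      = A d + ((A x \<bullet> V x) *\<^sub>R V x + (A x \<bullet> d) *\<^sub>R x)"
    using dderiv_cong[OF nabla_eq[OF V] x] by (simp add: d_def skew)
  then have 1: "nabla S V (nabla S V \<sigma>) x = A d + (A x \<bullet> d) *\<^sub>R x + (A x \<bullet> V x) *\<^sub>R V x"
    using xV inner_skew[of x d]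
    by (simp add: nabla_sphere_eq[OF V vector_field_sphere_nabla[OF V vector_field] x]
        sphere_nabla_def Let_def inner_simps algebra_simps)
  have "nabla S V V x = d + (V x \<bullet> V x) *\<^sub>R x"
    by (simp add: nabla_sphere_eq[OF V V x] sphere_nabla_def Let_def d_def[symmetric] xd)
  then have "nabla S (nabla S V V) \<sigma> x = A d + (V x \<bullet> V x) *\<^sub>R A x + (A x \<bullet> d) *\<^sub>R x"
    using skew[of x]
    by (simp add: nabla_eq[OF vector_field_sphere_nabla[OF V V] x] linear_add[OF linear]
        linear_cmul[OF linear] inner_simps)
  with 1 show ?thesis by (simp add: nabla2_def)
qed

text \<open>The differential at \<open>v\<close> is \<open>A x \<bullet> A v\<close>, which skewness
  turns into \<open>- A (A x) \<bullet> v\<close>. The gradient is the tangential projection of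
  \<open>- A (A x)\<close>.\<close>

lemma gradient_half_norm_sq:
  assumes x: "x \<in> S"
  shows "gradient S (half_norm_sq \<sigma>) x = - A (A x) - (A x \<bullet> A x) *\<^sub>R x" (is "_ = ?G")
proof -
  have xx: "x \<bullet> x = 1" using x by (simp add: dot_square_norm)
  have d: "dderiv S (half_norm_sq \<sigma>) x v = A x \<bullet> A v" if "v \<in> tangent_space S x" for v
  proof -
    have "((\<lambda>y. A y \<bullet> A y / 2) has_derivative (\<lambda>h. (A x \<bullet> A h + A h \<bullet> A x) / 2)) (at x within S)"
      by (auto intro!: derivative_eq_intros bounded_linear_imp_has_derivative[OF bounded_linear_A] simp: fun_eq_iff)
    from dderiv_eq[OF this that]
    have "dderiv S (\<lambda>y. A y \<bullet> A y / 2) x v = A x \<bullet> A v" by (simp add: inner_commute)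
    moreover have "dderiv S (half_norm_sq \<sigma>) x = dderiv S (\<lambda>y. A y \<bullet> A y / 2) x"
      by (rule dderiv_cong[OF _ x]) (simp add: half_norm_sq_def eq power2_norm_eq_inner)
    ultimately show ?thesis by simp
  qed
  have G: "?G \<in> tangent_space S x" "?G \<bullet> v = A x \<bullet> A v" if "v \<in> tangent_space S x" for v
    using that x xx inner_skew[of x "A x"] inner_skew[of "A x" v]
    by (auto simp: tangent_space_sphere inner_simps)
  \<comment> \<open>Both facts in \<open>G\<close> were proved under the assumption of a tangent
    \<open>v\<close>; zero supplies one for the first.\<close>
  have T0: "0 \<in> tangent_space S x" using x by (simp add: tangent_space_sphere)
  show ?thesis unfolding gradient_def
  proof (rule the_equality)
    show "?G \<in> tangent_space S x \<and> (\<forall>v\<in>tangent_space S x. ?G \<bullet> v = dderiv S (half_norm_sq \<sigma>) x v)"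
      using G(1)[OF T0] G(2) d by simp
  next
    fix w assume w: "w \<in> tangent_space S x \<and>
      (\<forall>v\<in>tangent_space S x. w \<bullet> v = dderiv S (half_norm_sq \<sigma>) x v)"
    have t: "w - ?G \<in> tangent_space S x"
      using w G(1)[OF T0] x by (simp add: tangent_space_sphere inner_diff_right)
    then have "(w - ?G) \<bullet> (w - ?G) = 0"
      using w d[OF t] G(2)[OF t] by (simp add: inner_diff_left)
    then show "w = ?G" by simp
  qed
qed

lemma vector_field_X_field: "vector_field S (X_field S \<sigma>)"
proof (rule vector_field_cong)
  have "smooth_fun S (\<lambda>y. - A (A y))"
    by (intro smooth_fun_bounded_linear bounded_linear_minus bounded_linear_compose[OF bounded_linear_A bounded_linear_A])
  then show "vector_field S (\<lambda>y. - A (A y) - (y \<bullet> - A (A y)) *\<^sub>R y)"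
    by (rule vector_field_sphere_proj)
next
  fix y assume "y \<in> S"
  then show "- A (A y) - (y \<bullet> - A (A y)) *\<^sub>R y = X_field S \<sigma> y"
    using inner_skew[of y "A y"] by (simp add: X_field_def gradient_half_norm_sq)
qed

text \<open>This is the Hessian of \<open>half_norm_sq \<sigma>\<close> on the diagonal. Terms along
  \<open>x\<close> disappear against the tangent vector \<open>V x\<close>.\<close>

lemma nabla_X_field_inner:
  assumes V: "vector_field S V" and x: "x \<in> S"
  shows "nabla S V (X_field S \<sigma>) x \<bullet> V x = A (V x) \<bullet> A (V x) - (A x \<bullet> A x) * (V x \<bullet> V x)"
proof -
  have tV: "V x \<in> tangent_space S x"
    using V x by (auto simp: vector_field_def)
  have xV: "x \<bullet> V x = 0" "V x \<bullet> x = 0"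
    using vector_field_sphere_orth[OF V x] by auto
  have "((\<lambda>y. - A (A y) - (A y \<bullet> A y) *\<^sub>R y) has_derivative
     (\<lambda>h. - A (A h) - ((A x \<bullet> A x) *\<^sub>R h + (A x \<bullet> A h + A h \<bullet> A x) *\<^sub>R x))) (at x within S)"
    by (intro derivative_intros bounded_linear.has_derivative[OF bounded_linear_A]
        bounded_linear_imp_has_derivative[OF bounded_linear_A])
  from dderiv_eq[OF this tV]
  have "dderiv S (X_field S \<sigma>) x (V x)
     = - A (A (V x)) - ((A x \<bullet> A x) *\<^sub>R V x + (A x \<bullet> A (V x) + A (V x) \<bullet> A x) *\<^sub>R x)"
    using dderiv_cong[OF gradient_half_norm_sq x] by (simp add: X_field_def)
  then show ?thesis
    using xV inner_skew[of "V x" "A (V x)"]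
    by (simp add: nabla_sphere_eq[OF V vector_field_X_field x] sphere_nabla_def Let_def
        inner_simps inner_commute)
qed

lemma laplacian_half_norm_sq:
  assumes "x \<in> S"
  shows "laplacian S (half_norm_sq \<sigma>) x
    = (\<Sum>V\<in>frame_at S x. A x \<bullet> A x - A (V x) \<bullet> A (V x))"
proof -
  have "is_frame_at S x (frame_at S x)" by (rule is_frame_at_frame_at_sphere[OF assms])
  then have V: "vector_field S V" "V x \<bullet> V x = 1" if "V \<in> frame_at S x" for V
    using that by (auto simp: is_frame_at_def)
  show ?thesis
    unfolding laplacian_def divergence_def X_field_def[symmetric]
    by (simp add: sum_negf[symmetric] nabla_X_field_inner[OF V(1) assms] V(2) cong: sum.cong)
qed

text \<open>Tracing \<open>nabla2_eq\<close> over an orthonormal frame, the first term sums to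
  \<open>A x\<close> by expansion in the frame, and the second to \<open>A x\<close> times the
  dimension of the sphere.\<close>

lemma rough_laplacian_eq:
  assumes x: "x \<in> S"
  shows "rough_laplacian S \<sigma> x = (real DIM('a) - 2) *\<^sub>R A x"
proof -
  let ?E = "frame_at S x" and ?T = "tangent_space S x"
  have "is_frame_at S x ?E" by (rule is_frame_at_frame_at_sphere[OF x])
  then have fin: "finite ?E" and V: "\<And>V. V \<in> ?E \<Longrightarrow> vector_field S V"
    and on: "\<And>V W. V \<in> ?E \<Longrightarrow> W \<in> ?E \<Longrightarrow> V x \<bullet> W x = (if V = W then 1 else 0)"
    and sp: "span ((\<lambda>V. V x) ` ?E) = ?T"
    by (auto simp: is_frame_at_def)
  have inj: "inj_on (\<lambda>V. V x) ?E"
  proof (rule inj_onI)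
    fix V W assume "V \<in> ?E" "W \<in> ?E" "V x = W x"
    then show "V = W" using on[of V W] on[of W W] by (auto split: if_splits)
  qed
  have po: "pairwise orthogonal ((\<lambda>V. V x) ` ?E)"
    using on by (auto simp: pairwise_def orthogonal_def)
  have "0 \<notin> (\<lambda>V. V x) ` ?E" using on by force
  then have "independent ((\<lambda>V. V x) ` ?E)"
    using po pairwise_orthogonal_independent by blast
  then have "card ((\<lambda>V. V x) ` ?E) = dim ?T"
    unfolding sp[symmetric] dim_span by (simp add: dim_eq_card_independent)
  moreover have "dim ?T = DIM('a) - 1"
    using x unfolding tangent_space_sphere[OF x] by (intro dim_hyperplane) auto
  ultimately have card: "card ?E = DIM('a) - 1"
    by (simp add: card_image[OF inj])
  have Ax: "A x \<in> span ((\<lambda>V. V x) ` ?E)"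
    unfolding sp using skew[of x] x by (simp add: tangent_space_sphere inner_commute)
  \<comment> \<open>The defect of the expansion lies in the span of the frame and is orthogonal to
    it, hence zero.\<close>
  define r where "r = A x - (\<Sum>V\<in>?E. (A x \<bullet> V x) *\<^sub>R V x)"
  have "r \<in> span ((\<lambda>V. V x) ` ?E)"
    unfolding r_def by (intro span_diff Ax span_sum span_mul span_base imageI)
  moreover have "r \<bullet> W x = 0" if "W \<in> ?E" for W
  proof -
    have "(\<Sum>V\<in>?E. (A x \<bullet> V x) * (V x \<bullet> W x)) = (\<Sum>V\<in>?E. if V = W then A x \<bullet> W x else 0)"
      by (rule sum.cong) (use on that in auto)
    then show ?thesis
      using that fin by (simp add: r_def inner_diff_left inner_sum_left)
  qed
  then have "orthogonal r z" if "z \<in> span ((\<lambda>V. V x) ` ?E)" for z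
    using that by (intro orthogonal_to_span[of z]) (auto simp: orthogonal_def)
  ultimately have "r = 0" using orthogonal_self by blast
  then have expand: "(\<Sum>V\<in>?E. (A x \<bullet> V x) *\<^sub>R V x) = A x" by (simp add: r_def)
  have "rough_laplacian S \<sigma> x = - (\<Sum>V\<in>?E. (A x \<bullet> V x) *\<^sub>R V x - A x)"
    unfolding rough_laplacian_def using V on x by (simp add: nabla2_eq cong: sum.cong)
  also have "\<dots> = (real (card ?E) - 1) *\<^sub>R A x"
    by (simp only: sum_subtractf expand sum_constant_scaleR) (simp add: algebra_simps)
  finally show ?thesis
    using DIM_positive[where 'a='a] by (simp add: card of_nat_diff)
qed

end

section \<open>Contradiction on the equator of the 2-sphere\<close>

theorem proposition3p4:
  fixes p q :: real
  assumes "p > 0" and "q \<ge> 0"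
  shows "\<not> (\<exists>\<sigma> :: real ^ 3 \<Rightarrow> real ^ 3.
            killing_field (sphere 0 1) \<sigma> \<and>
            (\<exists>x \<in> sphere 0 1. \<sigma> x \<noteq> 0) \<and>
            pq_harmonic (sphere 0 1) p q \<sigma>)"
proof
  let ?S = "sphere (0 :: real ^ 3) 1"
  assume "\<exists>\<sigma> :: real ^ 3 \<Rightarrow> real ^ 3. killing_field ?S \<sigma> \<and>
            (\<exists>x \<in> ?S. \<sigma> x \<noteq> 0) \<and> pq_harmonic ?S p q \<sigma>"
  then obtain \<sigma> :: "real ^ 3 \<Rightarrow> real ^ 3" and x0 where K: "killing_field ?S \<sigma>"
    and x0: "x0 \<in> ?S" "\<sigma> x0 \<noteq> 0" and H: "pq_harmonic ?S p q \<sigma>" by blast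
  obtain w where w: "\<And>y. y \<in> ?S \<Longrightarrow> \<sigma> y = cross3 w y"
    using killing_field_sphere_eq_cross3[OF K] by blast
  interpret skew_linear_field "cross3 w" \<sigma>
    by (intro skew_linear_field.intro linearI) (simp_all add: w cross_add_right cross_mult_right dot_cross_self)
  have w0: "w \<noteq> 0" using x0 w by auto
  \<comment> \<open>Normalizing \<open>z\<close> gives a point of the equator, where
    \<open>|\<sigma>|\<close> is maximal.\<close>
  obtain z :: "real ^ 3" where z: "z \<noteq> 0" "orthogonal w z"
    using orthogonal_to_vector_exists[of w] by auto
  define x where "x = z /\<^sub>R norm z"
  have x: "x \<in> ?S" "w \<bullet> x = 0" "x \<bullet> x = 1"
    using z by (auto simp: x_def orthogonal_def dot_square_norm)
  define s where "s = w \<bullet> w"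
  have s: "s > 0" using w0 by (simp add: s_def)
  have cc: "cross3 w y \<bullet> cross3 w y = s * (y \<bullet> y) - (w \<bullet> y)\<^sup>2" for y
    by (simp add: s_def dot_cross power2_eq_square inner_commute)
  have sx: "\<sigma> x \<bullet> \<sigma> x = s" using w x cc by simp
  \<comment> \<open>On the equator \<open>cross3 w (cross3 w x)\<close> is \<open>- s\<close> times
    \<open>x\<close>, so the two terms of the gradient cancel.\<close>
  have X0: "X_field ?S \<sigma> x = 0"
    using x cc by (simp add: X_field_def gradient_half_norm_sq Lagrange s_def)
  have frame: "is_frame_at ?S x (frame_at ?S x)" by (rule is_frame_at_frame_at_sphere[OF x(1)])
  have nn: "nabla_norm_sq ?S \<sigma> x = 0"
    unfolding nabla_norm_sq_def
  proof (intro sum.neutral ballI)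
    fix V assume "V \<in> frame_at ?S x"
    then have V: "vector_field ?S V" using frame by (auto simp: is_frame_at_def)
    have xV: "x \<bullet> V x = 0" using vector_field_sphere_orth[OF V x(1)] by simp
    \<comment> \<open>Both \<open>w\<close> and \<open>V x\<close> are orthogonal to
      \<open>x\<close>, so their cross product is parallel to \<open>x\<close> and has no tangential
      part.\<close>
    have "cross3 x (cross3 w (V x)) = 0"
      using xV x by (simp add: Lagrange inner_commute)
    then have "cross3 x (cross3 x (cross3 w (V x))) = 0" by simp
    then have "cross3 w (V x) = (x \<bullet> cross3 w (V x)) *\<^sub>R x"
      using x by (simp add: Lagrange[of x x])
    then show "(norm (nabla ?S V \<sigma> x))\<^sup>2 = 0"
      using inner_skew[of x "V x"] by (simp add: nabla_eq[OF V x(1)])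
  qed
  \<comment> \<open>By \<open>cc\<close> each summand equals
    \<open>(w \<bullet> V x)\<^sup>2\<close>.\<close>
  have lap: "laplacian ?S (half_norm_sq \<sigma>) x \<ge> 0"
    unfolding laplacian_half_norm_sq[OF x(1)]
    using frame x by (intro sum_nonneg) (simp add: cc is_frame_at_def)
  have nX: "nabla ?S (X_field ?S \<sigma>) \<sigma> x = 0"
    using nabla_eq[OF vector_field_X_field x(1)] by (simp add: X0)
  have "(1 + (norm (\<sigma> x))\<^sup>2) *\<^sub>R rough_laplacian ?S \<sigma> x
              + (2 * p) *\<^sub>R nabla ?S (X_field ?S \<sigma>) \<sigma> x
            = (p * nabla_norm_sq ?S \<sigma> x - p * q * (norm (X_field ?S \<sigma> x))\<^sup>2
               - q * (1 + (norm (\<sigma> x))\<^sup>2) * laplacian ?S (half_norm_sq \<sigma>) x) *\<^sub>R \<sigma> x"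
    using H x(1) unfolding pq_harmonic_def by blast
  \<comment> \<open>The factor \<open>DIM('a) - 2\<close> of the rough Laplacian is 1 here.\<close>
  then have "(1 + s) *\<^sub>R \<sigma> x = (- q * (1 + s) * laplacian ?S (half_norm_sq \<sigma>) x) *\<^sub>R \<sigma> x"
    by (simp add: rough_laplacian_eq[OF x(1)] w[OF x(1), symmetric] nX nn X0
        power2_norm_eq_inner sx)
  then have "(1 + s) * s = - q * (1 + s) * laplacian ?S (half_norm_sq \<sigma>) x * s"
    using sx by (metis inner_scaleR_left)
  moreover have "(1 + s) * s > 0" using s by simp
  moreover have "q * (1 + s) * laplacian ?S (half_norm_sq \<sigma>) x * s \<ge> 0"
    using s lap assms by simp
  ultimately show False by simp
qed

end
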